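(* For $j\in[p]=\{1,\dots,p\}$ let $h^j=f^j+g^j$ with $f^j:\mathbb{R}^n\to\mathbb{R}^m$ continuously differentiable and $g^j:\mathbb{R}^n\to\mathbb{R}^m\cup\{+\infty_C\}$ proper, closed and $C$-convex, and let $H(x)=\{h^1(x),\dots,h^p(x)\}$. Let $x^0\in\mathrm{dom}(H)$ and assume that $H$ satisfies the following: with $\mathcal{L}:=\{x\in\mathbb{R}^n: H(x)\preceq^\ell H(x^0)\}$, for every sequence of sets $\{S_k\}_{k\ge0}$ with each $S_k\in\{H(x):x\in\mathcal{L}\}$ and $S_{k+1}\preceq^\ell S_k$ for all $k$, there exists a bounded set $S\subseteq\mathbb{R}^m$ with $S\preceq^\ell S_k$ for all $k\in\mathbb{N}\cup\{0\}$. Assume that $\nabla f^j$ is Lipschitz continuous with Lipschitz constant $L^j$ for every $j\in[p]$ and let $L:=\max\{L^j:j\in[p]\}$. Let $\{x^k\}$ be an infinite sequence of non-stationary points in $\mathrm{dom}(H)$ of the problem $\preceq^\ell$-$\min_{x\in\mathbb{R}^n} H(x)$, generated from $x^0$ by the proximal gradient method with line search with parameters $\rho,\mu\in(0,1)$ and $l>0$ (defined in the context). Then there is a constant $\mathcal{C}_1>0$ (independent of $\hat k$) such that for any $\hat k\in\mathbb{N}$ there exists $k\in\{0,1,\dots,\hat k\}$ with $$|\Theta_l(x^k)|<\frac{\mathcal{C}_1}{\hat k}.$$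
   Context: $C\subset\mathbb{R}^m$ is a closed, convex, pointed cone with nonempty interior; $w\preceq_C w'$ iff $w'-w\in C$, $w\prec_C w'$ iff $w'-w\in\mathrm{int}(C)$. The extra element $+\infty_C$ satisfies $w\prec_C+\infty_C$ for all $w\in\mathbb{R}^m$. For sets, $U\preceq^\ell V$ iff $V\subseteq U+C$, i.e. for every $v\in V$ there is $u\in U$ with $u\preceq_C v$. $\mathrm{dom}(H):=\{x:h^j(x)\prec_C+\infty_C\ \forall j\in[p]\}$. $C^*=\{z:w^\top z\ge0\ \forall w\in C\}$, $\mathcal{Z}:=\{z\in C^*:\|z\|=1\}$, $\phi(w):=\sup_{z\in\mathcal{Z}}z^\top w$, with $z^\top(+\infty_C):=+\infty$ for $z\in C^*\setminus\{0\}$ and $\phi(+\infty_C):=+\infty$. $\nabla f^j(x)\in\mathbb{R}^{n\times m}$ is the transposed Jacobian; norms are Euclidean on vectors and the induced operator norm on matrices. $\mathbb{N}=\{1,2,\dots\}$. A function $g:\mathbb{R}^n\to\mathbb{R}^m\cup\{+\infty_C\}$ is $C$-convex if $g(\lambda x+(1-\lambda)y)\preceq_C\lambda g(x)+(1-\lambda)g(y)$ for all $x,y$ and $\lambda\in(0,1]$; proper if not identically $+\infty_C$; closed if $x\mapsto z^\top g(x)$ is lower semicontinuous for every $z\in C^*\setminus\{0\}$. Minimal set: $\mathcal{M}(U,C):=\{u\in U:\nexists\,u'\in U,\ u'\ne u,\ u'\preceq_C u\}$; $\omega(x):=|\mathcal{M}(H(x),C)|$, $[\omega(x)]=\{1,\dots,\omega(x)\}$.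 Partition set: enumerate $\mathcal{M}(H(x),C)=\{u_1^x,\dots,u_{\omega(x)}^x\}$ and, with $I_u(x):=\{j\in[p]:h^j(x)=u\}$, put $P_x:=\prod_{j=1}^{\omega(x)}I_{u_j^x}(x)$; elements are written $a=(a_1,\dots,a_{\omega(x)})$. For $x\in\mathrm{dom}(H)$, $$\Theta_l(x):=\min_{(a,v)\in P_x\times\mathbb{R}^n}\left\{\max_{j\in[\omega(x)]}\phi\left(\nabla f^{a_j}(x)^\top v+g^{a_j}(x+v)-g^{a_j}(x)\right)+\frac l2\|v\|^2\right\}$$ (the minimum is attained). Directional derivative: $D_vh(y):=\lim_{\alpha\to0^+}\frac1\alpha(h(y+\alpha v)-h(y))$ in the extended sense: $D_vh(y)\in-\mathrm{int}(C)$ means $\lim_{\alpha\to0^+}\frac1\alpha z^\top(h(y+\alpha v)-h(y))<0$ in $[-\infty,+\infty]$ for all $z\in C^*\setminus\{0\}$. A point $y\in\mathrm{dom}(H)$ is stationary if for every $a\in P_y$ and every $v\in\mathbb{R}^n$ there is $j\in[\omega(y)]$ with $D_vh^{a_j}(y)\notin-\mathrm{int}(C)$; otherwise non-stationary. Proximal gradient method with line search (stopping test disregarded): at iterate $x^k$, with $\omega_k:=\omega(x^k)$, choose a minimizer $(a^l_k,v^k_l)\in P_{x^k}\times\mathbb{R}^n$ of the problem defining $\Theta_l(x^k)$; let $\alpha_k=\mu^i$ with $i\in\mathbb{N}\cup\{0\}$ the smallest exponent such that, writing $a^l_k=(a^l_{k,1},\dots,a^l_{k,\omega_k})$, $$h^{a^l_{k,j}}(x^k+\mu^iv^k_l)\preceq_C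 h^{a^l_{k,j}}(x^k)+\rho\mu^i\left(\nabla f^{a^l_{k,j}}(x^k)^\top v^k_l+g^{a^l_{k,j}}(x^k+v^k_l)-g^{a^l_{k,j}}(x^k)\right)\quad\forall j\in[\omega_k];$$ set $x^{k+1}:=x^k+\alpha_kv^k_l$. *)

theory Defs
  imports "HOL-Analysis.Analysis"
begin

section \<open>The extended image space\<close>

text \<open>The type \<open>(real ^ 'm) cext\<close> is $R^m$ with the extra element $+\infty_C$ (here \<open>PInf\<close>).\<close>

datatype 'a cext = Fin 'a | PInf

text \<open>\<open>PInf\<close> is absorbing for addition and for scaling. Scaling is only used with nonnegative
  factors; the factor 0 occurs only in the convexity inequality for \<open>t = 1\<close>, where it is
  irrelevant whether \<open>0 *\<^sub>R PInf\<close> is read as \<open>PInf\<close> or as \<open>Fin 0\<close>. In differences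
  \<open>a - b\<close> the subtrahend \<open>b\<close> is always finite; the value of \<open>a - PInf\<close> is immaterial.\<close>

instantiation cext :: (plus) plus
begin
definition "a + b = (case (a, b) of (Fin u, Fin v) \<Rightarrow> Fin (u + v) | _ \<Rightarrow> PInf)"
instance ..
end

instantiation cext :: (minus) minus
begin
definition "a - b = (case (a, b) of (Fin u, Fin v) \<Rightarrow> Fin (u - v) | _ \<Rightarrow> PInf)"
instance ..
end

instantiation cext :: (scaleR) scaleR
begin
definition "c *\<^sub>R a = (case a of Fin u \<Rightarrow> Fin (c *\<^sub>R u) | PInf \<Rightarrow> PInf)"
instance ..
end


section \<open>The ordering cone\<close>

definition ordering_cone :: "(real ^ 'm) set \<Rightarrow> bool" where
  "ordering_cone C \<longleftrightarrow> closed C \<and> convex C \<and> cone C \<and>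
     (\<forall>w. w \<in> C \<and> - w \<in> C \<longrightarrow> w = 0) \<and> interior C \<noteq> {}"

fun cle :: "(real ^ 'm) set \<Rightarrow> (real ^ 'm) cext \<Rightarrow> (real ^ 'm) cext \<Rightarrow> bool" where
  "cle C (Fin w) (Fin w') \<longleftrightarrow> w' - w \<in> C"
| "cle C _ PInf \<longleftrightarrow> True"
| "cle C PInf (Fin _) \<longleftrightarrow> False"

fun cless :: "(real ^ 'm) set \<Rightarrow> (real ^ 'm) cext \<Rightarrow> (real ^ 'm) cext \<Rightarrow> bool" where
  "cless C (Fin w) (Fin w') \<longleftrightarrow> w' - w \<in> interior C"
| "cless C (Fin _) PInf \<longleftrightarrow> True"
| "cless C PInf _ \<longleftrightarrow> False"

definition set_le :: "(real ^ 'm) set \<Rightarrow> (real ^ 'm) cext set \<Rightarrow> (real ^ 'm) cext set \<Rightarrow> bool" where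
  "set_le C U V \<longleftrightarrow> (\<forall>v\<in>V. \<exists>u\<in>U. cle C u v)"

definition dual_cone :: "(real ^ 'm) set \<Rightarrow> (real ^ 'm) set" where
  "dual_cone C = {z. \<forall>w\<in>C. w \<bullet> z \<ge> 0}"

text \<open>The pairing $z^T w$; the second equation is meaningful for nonzero \<open>z\<close> in the dual cone.\<close>

fun pairing :: "real ^ 'm \<Rightarrow> (real ^ 'm) cext \<Rightarrow> ereal" where
  "pairing z (Fin w) = ereal (z \<bullet> w)"
| "pairing z PInf = \<infinity>"

fun phi :: "(real ^ 'm) set \<Rightarrow> (real ^ 'm) cext \<Rightarrow> ereal" where
  "phi C (Fin w) = (SUP z \<in> {z \<in> dual_cone C. norm z = 1}. ereal (z \<bullet> w))"
| "phi C PInf = \<infinity>"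


section \<open>Assumptions on the component functions\<close>

text \<open>The transposed Jacobian, an \<open>n\<close>-by-\<open>m\<close> matrix.\<close>

definition grad :: "(real ^ 'n \<Rightarrow> real ^ 'm) \<Rightarrow> real ^ 'n \<Rightarrow> real ^ 'm ^ 'n" where
  "grad f x = transpose (jacobian f (at x))"

definition cont_diff :: "(real ^ 'n \<Rightarrow> real ^ 'm) \<Rightarrow> bool" where
  "cont_diff f \<longleftrightarrow> (\<forall>x. f differentiable (at x)) \<and> continuous_on UNIV (grad f)"

text \<open>The library norm on matrices is the Frobenius norm, so the induced operator norm is
  written with \<^const>\<open>onorm\<close>.\<close>

definition grad_lipschitz :: "real \<Rightarrow> (real ^ 'n \<Rightarrow> real ^ 'm) \<Rightarrow> bool" where
  "grad_lipschitz L f \<longleftrightarrow>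
     (\<forall>x y. onorm (\<lambda>w. (grad f x - grad f y) *v w) \<le> L * norm (x - y))"

definition cproper :: "(real ^ 'n \<Rightarrow> (real ^ 'm) cext) \<Rightarrow> bool" where
  "cproper g \<longleftrightarrow> (\<exists>x. g x \<noteq> PInf)"

definition cconvex :: "(real ^ 'm) set \<Rightarrow> (real ^ 'n \<Rightarrow> (real ^ 'm) cext) \<Rightarrow> bool" where
  "cconvex C g \<longleftrightarrow> (\<forall>x y. \<forall>t. 0 < t \<and> t \<le> 1 \<longrightarrow>
     cle C (g (t *\<^sub>R x + (1 - t) *\<^sub>R y)) (t *\<^sub>R g x + (1 - t) *\<^sub>R g y))"

definition lsc :: "(real ^ 'n \<Rightarrow> ereal) \<Rightarrow> bool" where
  "lsc \<psi> \<longleftrightarrow> (\<forall>x. \<psi> x \<le> Liminf (at x) \<psi>)"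

definition cclosed :: "(real ^ 'm) set \<Rightarrow> (real ^ 'n \<Rightarrow> (real ^ 'm) cext) \<Rightarrow> bool" where
  "cclosed C g \<longleftrightarrow> (\<forall>z \<in> dual_cone C - {0}. lsc (\<lambda>x. pairing z (g x)))"


section \<open>The set-valued map, minimal elements and the partition set\<close>

text \<open>The family \<open>h\<close> is indexed by \<open>{1..p}\<close>; \<open>set_map p h\<close> is the set-valued map $H$.\<close>

definition set_map ::
    "nat \<Rightarrow> (nat \<Rightarrow> real ^ 'n \<Rightarrow> (real ^ 'm) cext) \<Rightarrow> real ^ 'n \<Rightarrow> (real ^ 'm) cext set" where
  "set_map p h x = (\<lambda>j. h j x) ` {1..p}"

definition dom_map ::
    "(real ^ 'm) set \<Rightarrow> nat \<Rightarrow> (nat \<Rightarrow> real ^ 'n \<Rightarrow> (real ^ 'm) cext) \<Rightarrow> (real ^ 'n) set" where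
  "dom_map C p h = {x. \<forall>j\<in>{1..p}. cless C (h j x) PInf}"

definition minimal_set ::
    "(real ^ 'm) set \<Rightarrow> (real ^ 'm) cext set \<Rightarrow> (real ^ 'm) cext set" where
  "minimal_set C U = {u \<in> U. \<not> (\<exists>u'\<in>U. u' \<noteq> u \<and> cle C u' u)}"

definition omega ::
    "(real ^ 'm) set \<Rightarrow> nat \<Rightarrow> (nat \<Rightarrow> real ^ 'n \<Rightarrow> (real ^ 'm) cext) \<Rightarrow> real ^ 'n \<Rightarrow> nat" where
  "omega C p h x = card (minimal_set C (set_map p h x))"

text \<open>\<open>enum x j\<close> plays the role of $u_j^x$: for every \<open>x\<close>, the map \<open>enum x\<close> enumerates the
  minimal elements of $H(x)$ without repetition.\<close>

definition minimal_enum ::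
    "(real ^ 'm) set \<Rightarrow> nat \<Rightarrow> (nat \<Rightarrow> real ^ 'n \<Rightarrow> (real ^ 'm) cext) \<Rightarrow>
     (real ^ 'n \<Rightarrow> nat \<Rightarrow> (real ^ 'm) cext) \<Rightarrow> bool" where
  "minimal_enum C p h enum \<longleftrightarrow>
     (\<forall>x. bij_betw (enum x) {1..omega C p h x} (minimal_set C (set_map p h x)))"

definition partition_set ::
    "(real ^ 'm) set \<Rightarrow> nat \<Rightarrow> (nat \<Rightarrow> real ^ 'n \<Rightarrow> (real ^ 'm) cext) \<Rightarrow>
     (real ^ 'n \<Rightarrow> nat \<Rightarrow> (real ^ 'm) cext) \<Rightarrow> real ^ 'n \<Rightarrow> (nat \<Rightarrow> nat) set" where
  "partition_set C p h enum x =
     (\<Pi>\<^sub>E j\<in>{1..omega C p h x}. {i \<in> {1..p}. h i x = enum x j})"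


section \<open>Stationarity\<close>

text \<open>\<open>dir_deriv_neg C h y v\<close> says that the directional derivative of \<open>h\<close> at \<open>y\<close> along \<open>v\<close>,
  in the extended sense, lies in $-\mathrm{int}(C)$.\<close>

definition dir_deriv_neg ::
    "(real ^ 'm) set \<Rightarrow> (real ^ 'n \<Rightarrow> (real ^ 'm) cext) \<Rightarrow> real ^ 'n \<Rightarrow> real ^ 'n \<Rightarrow> bool" where
  "dir_deriv_neg C h y v \<longleftrightarrow> (\<forall>z \<in> dual_cone C - {0}. \<exists>d. d < 0 \<and>
     ((\<lambda>\<alpha>::real. ereal (1 / \<alpha>) * pairing z (h (y + \<alpha> *\<^sub>R v) - h y)) \<longlongrightarrow> d) (at_right 0))"

definition stationary ::
    "(real ^ 'm) set \<Rightarrow> nat \<Rightarrow> (nat \<Rightarrow> real ^ 'n \<Rightarrow> (real ^ 'm) cext) \<Rightarrow>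
     (real ^ 'n \<Rightarrow> nat \<Rightarrow> (real ^ 'm) cext) \<Rightarrow> real ^ 'n \<Rightarrow> bool" where
  "stationary C p h enum y \<longleftrightarrow> y \<in> dom_map C p h \<and>
     (\<forall>a \<in> partition_set C p h enum y. \<forall>v.
        \<exists>j\<in>{1..omega C p h y}. \<not> dir_deriv_neg C (h (a j)) y v)"


section \<open>The proximal gradient method with line search\<close>

definition model ::
    "(real ^ 'n \<Rightarrow> real ^ 'm) \<Rightarrow> (real ^ 'n \<Rightarrow> (real ^ 'm) cext) \<Rightarrow> real ^ 'n \<Rightarrow> real ^ 'n \<Rightarrow>
     (real ^ 'm) cext" where
  "model f g x v = Fin (transpose (grad f x) *v v) + g (x + v) - g x"

text \<open>The component functions $h^j = f^j + g^j$.\<close>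

definition sum_map ::
    "(nat \<Rightarrow> real ^ 'n \<Rightarrow> real ^ 'm) \<Rightarrow> (nat \<Rightarrow> real ^ 'n \<Rightarrow> (real ^ 'm) cext) \<Rightarrow>
     nat \<Rightarrow> real ^ 'n \<Rightarrow> (real ^ 'm) cext" where
  "sum_map f g j x = Fin (f j x) + g j x"

definition objective ::
    "(real ^ 'm) set \<Rightarrow> nat \<Rightarrow> (nat \<Rightarrow> real ^ 'n \<Rightarrow> real ^ 'm) \<Rightarrow>
     (nat \<Rightarrow> real ^ 'n \<Rightarrow> (real ^ 'm) cext) \<Rightarrow> real \<Rightarrow> real ^ 'n \<Rightarrow>
     (nat \<Rightarrow> nat) \<times> (real ^ 'n) \<Rightarrow> ereal" where
  "objective C p f g l x = (\<lambda>(a, v).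
     Max ((\<lambda>j. phi C (model (f (a j)) (g (a j)) x v)) ` {1..omega C p (sum_map f g) x})
     + ereal (l / 2 * (norm v)\<^sup>2))"

definition feasible ::
    "(real ^ 'm) set \<Rightarrow> nat \<Rightarrow> (nat \<Rightarrow> real ^ 'n \<Rightarrow> real ^ 'm) \<Rightarrow>
     (nat \<Rightarrow> real ^ 'n \<Rightarrow> (real ^ 'm) cext) \<Rightarrow> (real ^ 'n \<Rightarrow> nat \<Rightarrow> (real ^ 'm) cext) \<Rightarrow>
     real ^ 'n \<Rightarrow> ((nat \<Rightarrow> nat) \<times> (real ^ 'n)) set" where
  "feasible C p f g enum x = partition_set C p (sum_map f g) enum x \<times> UNIV"

text \<open>\<open>Theta\<close> is a minimum, not just an infimum: for \<open>x\<close> in the domain it is attained.\<close>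

definition Theta ::
    "(real ^ 'm) set \<Rightarrow> nat \<Rightarrow> (nat \<Rightarrow> real ^ 'n \<Rightarrow> real ^ 'm) \<Rightarrow>
     (nat \<Rightarrow> real ^ 'n \<Rightarrow> (real ^ 'm) cext) \<Rightarrow> (real ^ 'n \<Rightarrow> nat \<Rightarrow> (real ^ 'm) cext) \<Rightarrow>
     real \<Rightarrow> real ^ 'n \<Rightarrow> ereal" where
  "Theta C p f g enum l x =
     (LEAST t. t \<in> objective C p f g l x ` feasible C p f g enum x)"

definition line_search_cond ::
    "(real ^ 'm) set \<Rightarrow> nat \<Rightarrow> (nat \<Rightarrow> real ^ 'n \<Rightarrow> real ^ 'm) \<Rightarrow>
     (nat \<Rightarrow> real ^ 'n \<Rightarrow> (real ^ 'm) cext) \<Rightarrow> real \<Rightarrow> real \<Rightarrow> real ^ 'n \<Rightarrow>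
     (nat \<Rightarrow> nat) \<Rightarrow> real ^ 'n \<Rightarrow> nat \<Rightarrow> bool" where
  "line_search_cond C p f g \<rho> \<mu> x a v i \<longleftrightarrow>
     (\<forall>j\<in>{1..omega C p (sum_map f g) x}.
        cle C (sum_map f g (a j) (x + \<mu> ^ i *\<^sub>R v))
              (sum_map f g (a j) x + (\<rho> * \<mu> ^ i) *\<^sub>R model (f (a j)) (g (a j)) x v))"

definition prox_grad_step ::
    "(real ^ 'm) set \<Rightarrow> nat \<Rightarrow> (nat \<Rightarrow> real ^ 'n \<Rightarrow> real ^ 'm) \<Rightarrow>
     (nat \<Rightarrow> real ^ 'n \<Rightarrow> (real ^ 'm) cext) \<Rightarrow> (real ^ 'n \<Rightarrow> nat \<Rightarrow> (real ^ 'm) cext) \<Rightarrow>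
     real \<Rightarrow> real \<Rightarrow> real \<Rightarrow> real ^ 'n \<Rightarrow> real ^ 'n \<Rightarrow> bool" where
  "prox_grad_step C p f g enum \<rho> \<mu> l x x' \<longleftrightarrow>
     (\<exists>a v i. is_arg_min (objective C p f g l x) (\<lambda>s. s \<in> feasible C p f g enum x) (a, v) \<and>
        line_search_cond C p f g \<rho> \<mu> x a v i \<and>
        (\<forall>i'<i. \<not> line_search_cond C p f g \<rho> \<mu> x a v i') \<and>
        x' = x + \<mu> ^ i *\<^sub>R v)"

end

(* The minimizing pair (a, v) beats v = 0, so Theta <= 0 and phi of every model value is at most
   Theta - (l/2) |v|^2. The quadratic slack absorbs the linearization error of the f^j, so the line
   search accepts every step size below a constant depending only on L, rho and l. Hence each
   value h^i(x^k) dominates some h^i'(x^(k+1)), with a gap at least delta |Theta(x^k)| in every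
   unit dual direction. Following such a chain of indices along one dual vector z telescopes to
   delta * sum |Theta(x^k)| <= z . h^1(x^0) + M, where M bounds the set B that lies below all
   H(x^k), and the smallest of the first K terms is at most the average. *)

theory Submission
  imports Defs
begin

section \<open>Cones and the order on the extended space\<close>

lemma zero_in_ordering_cone:
  assumes "ordering_cone C"
  shows "0 \<in> C"
proof -
  obtain c where "c \<in> C"
    using assms interior_subset unfolding ordering_cone_def by blast
  then have "0 *\<^sub>R c \<in> C"
    using assms unfolding ordering_cone_def cone_def by blast
  then show ?thesis by simp
qed

lemma ordering_cone_scaleR:
  assumes "ordering_cone C" "w \<in> C" "0 \<le> c"
  shows "c *\<^sub>R w \<in> C"
  using assms unfolding ordering_cone_def cone_def by blast

lemma ordering_cone_add:
  assumes "ordering_cone C" "v \<in> C" "w \<in> C"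
  shows "v + w \<in> C"
  using assms convex_cone[of C] unfolding ordering_cone_def by blast

text \<open>The bipolar theorem with normalized dual vectors: a point outside the closed convex cone
  is strictly separated from it, and the normal of the hyperplane, scaled to norm 1, is a dual
  vector negative at that point. All later membership proofs become scalar inequalities this
  way.\<close>

lemma mem_ordering_coneI:
  fixes w :: "real ^ 'm"
  assumes C: "ordering_cone C"
    and dual: "\<And>z. z \<in> dual_cone C \<Longrightarrow> norm z = 1 \<Longrightarrow> 0 \<le> z \<bullet> w"
  shows "w \<in> C"
proof (rule ccontr)
  assume "w \<notin> C"
  then obtain a b where ab: "a \<bullet> w < b" "\<And>x. x \<in> C \<Longrightarrow> b < a \<bullet> x"
    using separating_hyperplane_closed_point[of C w] C unfolding ordering_cone_def by metis
  have "b < 0"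
    using ab(2)[OF zero_in_ordering_cone[OF C]] by simp
  have nonneg: "0 \<le> a \<bullet> x" if "x \<in> C" for x
  proof (rule ccontr)
    assume neg: "\<not> 0 \<le> a \<bullet> x"
    \<comment> \<open>Both \<open>b\<close> and \<open>a \<bullet> x\<close> are negative, so this
      is a positive multiple of \<open>x\<close>. The functional \<open>a\<close> takes the value
      \<open>b\<close> at it, which strict separation forbids.\<close>
    have "(b / (a \<bullet> x)) *\<^sub>R x \<in> C"
      using C that \<open>b < 0\<close> neg by (intro ordering_cone_scaleR) (auto simp: divide_simps)
    from ab(2)[OF this] neg show False by simp
  qed
  have "a \<noteq> 0" using ab(1) \<open>b < 0\<close> by auto
  let ?z = "(1 / norm a) *\<^sub>R a"
  have "?z \<in> dual_cone C"
    using nonneg unfolding dual_cone_def by (simp add: inner_commute)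
  moreover have "norm ?z = 1" using \<open>a \<noteq> 0\<close> by simp
  ultimately have "0 \<le> ?z \<bullet> w" by (rule dual)
  then have "0 \<le> a \<bullet> w" using \<open>a \<noteq> 0\<close> by (simp add: zero_le_divide_iff)
  then show False using ab(1) \<open>b < 0\<close> by linarith
qed

text \<open>Without a unit dual vector the dual test for membership would hold vacuously and
  \<open>C\<close> would be the whole space, against pointedness, since \<open>real ^ 'm\<close> is
  never trivial.\<close>

lemma dual_cone_unit_exists:
  fixes C :: "(real ^ 'm) set"
  assumes C: "ordering_cone C"
  obtains z where "z \<in> dual_cone C" "norm z = 1"
proof (rule ccontr)
  assume "\<not> thesis"
  with that have none: "\<And>z. z \<in> dual_cone C \<Longrightarrow> norm z \<noteq> 1" by blast
  have "w \<in> C" for w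
    using mem_ordering_coneI[OF C] none by blast
  then have "\<forall>w. w = (0 :: real ^ 'm)"
    using C unfolding ordering_cone_def by blast
  then show False
    by (metis zero_neq_one one_index zero_index)
qed

lemma phi_Fin_le_iff:
  "phi C (Fin w) \<le> ereal c \<longleftrightarrow> (\<forall>z\<in>dual_cone C. norm z = 1 \<longrightarrow> z \<bullet> w \<le> c)"
  by (auto simp: SUP_le_iff)

text \<open>A unit dual vector keeps the supremum off the empty set, where it would be
  \<open>- \<infinity>\<close>; what remains is a supremum of zeros.\<close>

lemma phi_Fin_0:
  assumes "ordering_cone C"
  shows "phi C (Fin 0) = 0"
proof -
  have "{z \<in> dual_cone C. norm z = 1} \<noteq> {}"
    using dual_cone_unit_exists[OF assms] by blast
  then show ?thesis by (simp add: zero_ereal_def)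
qed

lemma phi_not_MInf:
  assumes "ordering_cone C"
  shows "phi C u \<noteq> - \<infinity>"
proof (cases u)
  case (Fin w)
  obtain z where "z \<in> dual_cone C" "norm z = 1"
    using dual_cone_unit_exists[OF assms] .
  then have "ereal (z \<bullet> w) \<le> phi C u"
    unfolding Fin phi.simps by (intro SUP_upper) simp
  then show ?thesis by auto
qed simp

section \<open>The cone order as a partial order, and minimal elements\<close>

lemma cle_refl: "ordering_cone C \<Longrightarrow> cle C u u"
  by (cases u) (simp_all add: zero_in_ordering_cone)

lemma cle_trans:
  assumes "ordering_cone C" "cle C u v" "cle C v w"
  shows "cle C u w"
proof (cases u; cases v; cases w)
  fix a b c assume u: "u = Fin a" and v: "v = Fin b" and w: "w = Fin c"
  then have "(b - a) + (c - b) \<in> C"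
    using assms by (intro ordering_cone_add) simp_all
  then show ?thesis using u w by simp
qed (use assms in auto)

lemma cle_antisym:
  assumes C: "ordering_cone C" and "cle C u v" "cle C v u"
  shows "u = v"
proof (cases u; cases v)
  fix a b assume u: "u = Fin a" and v: "v = Fin b"
  have "b - a \<in> C" "- (b - a) \<in> C"
    using assms(2,3) u v by simp_all
  then have "b - a = 0"
    using C unfolding ordering_cone_def by blast
  then show ?thesis using u v by simp
qed (use assms in auto)

lemma set_le_trans:
  assumes "ordering_cone C" "set_le C U V" "set_le C V W"
  shows "set_le C U W"
  using assms cle_trans unfolding set_le_def by metis

text \<open>Among the elements below \<open>u\<close>, take one with the fewest elements of
  \<open>U\<close> below it. By transitivity and antisymmetry, anything strictly below it would have
  a strictly smaller down-set.\<close>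

lemma minimal_set_below:
  assumes C: "ordering_cone C" and "finite U" "u \<in> U"
  obtains u' where "u' \<in> minimal_set C U" "cle C u' u"
proof -
  let ?D = "\<lambda>y. {x \<in> U. cle C x y}"
  define u' where "u' = arg_min_on (\<lambda>y. card (?D y)) (?D u)"
  have D: "finite (?D u)" "?D u \<noteq> {}"
    using assms cle_refl[OF C] by auto
  have u': "u' \<in> U" "cle C u' u"
    using arg_min_if_finite(1)[OF D, of "\<lambda>y. card (?D y)"] unfolding u'_def by auto
  have "\<not> cle C y u'" if y: "y \<in> U" "y \<noteq> u'" for y
  proof
    assume yu: "cle C y u'"
    then have "?D y \<subseteq> ?D u'" using cle_trans[OF C] by blast
    moreover have "u' \<in> ?D u'" "u' \<notin> ?D y"
      using u' cle_refl[OF C] cle_antisym[OF C yu] y by auto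
    ultimately have "card (?D y) < card (?D u')"
      using \<open>finite U\<close> by (intro psubset_card_mono) auto
    moreover have "y \<in> ?D u" using y yu u' cle_trans[OF C] by blast
    ultimately show False
      using arg_min_if_finite(2)[OF D, of "\<lambda>y. card (?D y)"] unfolding u'_def by blast
  qed
  then have "u' \<in> minimal_set C U" using u' unfolding minimal_set_def by blast
  with u'(2) that show ?thesis by blast
qed

section \<open>Linearization error\<close>

text \<open>The Lipschitz hypothesis is about the transposed Jacobian, whereas the derivative acts
  through the Jacobian. Cauchy-Schwarz gives |A^T v|^2 = v . A A^T v \<le> |v| |A| |A^T v|, and one
  factor |A^T v| cancels.\<close>

lemma onorm_transpose_le:
  fixes A :: "real ^ 'm ^ 'n"
  shows "onorm (\<lambda>v. transpose A *v v) \<le> onorm (\<lambda>w. A *v w)"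
proof (rule onorm_bound)
  have bl: "bounded_linear (\<lambda>w. A *v w)" by simp
  show "0 \<le> onorm (\<lambda>w. A *v w)" by (rule onorm_pos_le[OF bl])
  fix v
  let ?w = "transpose A *v v"
  have "(norm ?w)\<^sup>2 = (v v* A) \<bullet> ?w"
    by (simp add: power2_norm_eq_inner)
  also have "\<dots> = v \<bullet> (A *v ?w)" by (rule dot_lmul_matrix)
  also have "\<dots> \<le> norm v * norm (A *v ?w)" by (rule norm_cauchy_schwarz)
  also have "\<dots> \<le> norm v * (onorm (\<lambda>w. A *v w) * norm ?w)"
    by (intro mult_left_mono onorm[OF bl]) simp
  finally have "norm ?w * norm ?w \<le> (onorm (\<lambda>w. A *v w) * norm v) * norm ?w"
    by (simp add: power2_eq_square algebra_simps)
  then show "norm ?w \<le> onorm (\<lambda>w. A *v w) * norm v"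
    by (cases "?w = 0") (auto intro: mult_nonneg_nonneg onorm_pos_le[OF bl])
qed

text \<open>The mean value inequality on the ball of radius |d|, where the Jacobian differs from the
  one at \<open>x\<close> by at most L |d|. The sharp constant would be L/2; the cruder L only
  affects the size of the final constant.\<close>

lemma grad_linearization:
  fixes f :: "real ^ 'n \<Rightarrow> real ^ 'm"
  assumes f: "cont_diff f" and lip: "grad_lipschitz L f" and L: "0 \<le> L"
  shows "norm (f (x + d) - f x - transpose (grad f x) *v d) \<le> L * (norm d)\<^sup>2"
proof -
  let ?S = "cball x (norm d)"
  let ?J = "\<lambda>y h. jacobian f (at y) *v h"
  have "norm (f (x + d) - f x - ?J x (x + d - x)) \<le> norm (x + d - x) * (L * norm d)"
  proof (rule differentiable_bound_linearization[where S = ?S])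
    fix t :: real assume "t \<in> {0..1}"
    then show "x + t *\<^sub>R (x + d - x) \<in> ?S"
      by (auto simp: dist_norm intro: mult_left_le_one_le)
  next
    fix y assume y: "y \<in> ?S"
    show "(f has_derivative ?J y) (at y within ?S)"
      using f jacobian_works has_derivative_at_withinI unfolding cont_diff_def by blast
    have "?J y - ?J x = (\<lambda>h. transpose (grad f y - grad f x) *v h)"
      unfolding grad_def by (simp add: fun_eq_iff transpose_def vec_eq_iff matrix_vector_mult_def
          sum_subtractf algebra_simps)
    then have "onorm (?J y - ?J x) \<le> onorm (\<lambda>w. (grad f y - grad f x) *v w)"
      using onorm_transpose_le by metis
    also have "\<dots> \<le> L * norm (y - x)"
      using lip unfolding grad_lipschitz_def by blast
    also have "\<dots> \<le> L * norm d"
      using y L by (intro mult_left_mono) (auto simp: dist_norm norm_minus_commute)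
    finally show "onorm (?J y - ?J x) \<le> L * norm d" .
  qed simp
  then show ?thesis
    unfolding grad_def by (simp add: power2_eq_square algebra_simps)
qed

lemma grad_lipschitz_mono:
  assumes "grad_lipschitz L f" "L \<le> L'"
  shows "grad_lipschitz L' f"
  using assms unfolding grad_lipschitz_def
  by (meson mult_right_mono norm_ge_zero order_trans)

section \<open>One step of the method\<close>

lemma cext_Fin_simps:
  "Fin u + Fin v = Fin (u + v)" "Fin u - Fin v = Fin (u - v)" "c *\<^sub>R Fin w = Fin (c *\<^sub>R w)"
  by (simp_all add: plus_cext_def minus_cext_def scaleR_cext_def)

text \<open>The test asks for the fraction \<rho> of the predicted decrease. The remaining fraction
  1 - \<rho> is worth at least t (1 - \<rho>) (l/2) |v|^2 in every unit dual direction, which covers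
  the linearization error L t^2 |v|^2 for small \<open>t\<close>; convexity of \<open>g\<close>
  handles the nonsmooth part.\<close>

lemma line_search_accepts:
  fixes f :: "real ^ 'n \<Rightarrow> real ^ 'm"
  assumes C: "ordering_cone C"
    and f: "cont_diff f" "grad_lipschitz L f" "0 \<le> L"
    and g: "cconvex C g" "g x = Fin c" "g (x + v) = Fin d"
    and decrease: "phi C (model f g x v) \<le> ereal (- (l / 2 * (norm v)\<^sup>2))"
    and t: "0 < t" "t \<le> 1" "L * t \<le> (1 - \<rho>) * l / 2" and \<rho>: "\<rho> < 1"
  shows "cle C (Fin (f (x + t *\<^sub>R v)) + g (x + t *\<^sub>R v))
           ((Fin (f x) + g x) + (\<rho> * t) *\<^sub>R model f g x v)"
proof -
  define w where "w = transpose (grad f x) *v v + d - c"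
  have model: "model f g x v = Fin w"
    unfolding model_def w_def using g by (simp add: cext_Fin_simps)
  have "t *\<^sub>R (x + v) + (1 - t) *\<^sub>R x = x + t *\<^sub>R v"
    by (simp add: algebra_simps)
  then have "cle C (g (x + t *\<^sub>R v)) (Fin (t *\<^sub>R d + (1 - t) *\<^sub>R c))"
    using g t unfolding cconvex_def by (metis cext_Fin_simps(1,3))
  \<comment> \<open>The convexity bound is finite, and \<open>PInf\<close> is not below a finite
    element, so \<open>g\<close> is finite at the trial point.\<close>
  then obtain e where e: "g (x + t *\<^sub>R v) = Fin e" "t *\<^sub>R d + (1 - t) *\<^sub>R c - e \<in> C"
    by (cases "g (x + t *\<^sub>R v)") auto
  define r where "r = f (x + t *\<^sub>R v) - f x - t *\<^sub>R (transpose (grad f x) *v v)"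
  have "norm r \<le> L * (norm (t *\<^sub>R v))\<^sup>2"
    using grad_linearization[OF f, of x "t *\<^sub>R v"] unfolding r_def
    by (simp add: matrix_vector_mult_scaleR)
  also have "\<dots> = t * (L * t) * (norm v)\<^sup>2"
    by (simp add: power2_eq_square)
  also have "\<dots> \<le> t * ((1 - \<rho>) * l / 2) * (norm v)\<^sup>2"
    using t by (intro mult_right_mono mult_left_mono) auto
  finally have r: "norm r \<le> t * ((1 - \<rho>) * l / 2) * (norm v)\<^sup>2" .
  have "f x + c + (\<rho> * t) *\<^sub>R w - (f (x + t *\<^sub>R v) + e) \<in> C"
  proof (rule mem_ordering_coneI[OF C])
    fix z assume z: "z \<in> dual_cone C" "norm z = 1"
    \<comment> \<open>The slack in the test splits into the convexity slack of \<open>g\<close>, the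
      unspent share of the model decrease, and the linearization error \<open>r\<close>.\<close>
    have eq: "f x + c + (\<rho> * t) *\<^sub>R w - (f (x + t *\<^sub>R v) + e) =
        (t *\<^sub>R d + (1 - t) *\<^sub>R c - e) - ((1 - \<rho>) * t) *\<^sub>R w - r"
      unfolding w_def r_def by (simp add: algebra_simps)
    have "z \<bullet> w \<le> - (l / 2 * (norm v)\<^sup>2)"
      using decrease z unfolding model phi_Fin_le_iff by blast
    then have "(1 - \<rho>) * t * (z \<bullet> w) \<le> (1 - \<rho>) * t * (- (l / 2 * (norm v)\<^sup>2))"
      using t \<rho> by (intro mult_left_mono) auto
    also have "\<dots> = - (t * ((1 - \<rho>) * l / 2) * (norm v)\<^sup>2)"
      by (simp add: algebra_simps)
    finally have "(1 - \<rho>) * t * (z \<bullet> w) \<le> - (t * ((1 - \<rho>) * l / 2) * (norm v)\<^sup>2)" .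
    moreover have "z \<bullet> r \<le> norm r"
      using norm_cauchy_schwarz[of z r] z by simp
    moreover have "0 \<le> z \<bullet> (t *\<^sub>R d + (1 - t) *\<^sub>R c - e)"
      using e z unfolding dual_cone_def by (auto simp: inner_commute)
    moreover have "z \<bullet> (f x + c + (\<rho> * t) *\<^sub>R w - (f (x + t *\<^sub>R v) + e)) =
        z \<bullet> (t *\<^sub>R d + (1 - t) *\<^sub>R c - e) - (1 - \<rho>) * t * (z \<bullet> w) - z \<bullet> r"
      unfolding eq by (simp only: inner_diff_right inner_scaleR_right)
    ultimately show "0 \<le> z \<bullet> (f x + c + (\<rho> * t) *\<^sub>R w - (f (x + t *\<^sub>R v) + e))"
      using r by linarith
  qed
  then show ?thesis
    unfolding model e g(2) by (simp add: cext_Fin_simps)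
qed

section \<open>Selections of minimal values and the optimal value \<open>Theta\<close>\<close>

lemma omega_pos:
  assumes C: "ordering_cone C" and p: "1 \<le> p"
  shows "1 \<le> omega C p h x"
proof -
  have fin: "finite (set_map p h x)" and "h 1 x \<in> set_map p h x"
    using p by (auto simp: set_map_def)
  then obtain u where "u \<in> minimal_set C (set_map p h x)"
    using minimal_set_below[OF C] by blast
  moreover have "finite (minimal_set C (set_map p h x))"
    using fin unfolding minimal_set_def by simp
  ultimately show ?thesis
    unfolding omega_def by (metis card_0_eq empty_iff less_one not_less)
qed

text \<open>A selection \<open>a\<close> hits every minimal value, and every value lies above a
  minimal one. This is how inequalities tested only at the selected indices control all of
  H(x).\<close>

lemma partition_set_below:
  assumes C: "ordering_cone C" and enum: "minimal_enum C p h enum"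
    and a: "a \<in> partition_set C p h enum x" and i: "i \<in> {1..p}"
  obtains j where "j \<in> {1..omega C p h x}" "cle C (h (a j) x) (h i x)"
proof -
  have "finite (set_map p h x)" "h i x \<in> set_map p h x"
    using i by (auto simp: set_map_def)
  then obtain u where u: "u \<in> minimal_set C (set_map p h x)" "cle C u (h i x)"
    using minimal_set_below[OF C] by blast
  obtain j where j: "j \<in> {1..omega C p h x}" "enum x j = u"
    using enum u(1) unfolding minimal_enum_def bij_betw_def by (metis imageE)
  then have "h (a j) x = u"
    using PiE_mem[OF a[unfolded partition_set_def] j(1)] by simp
  with j(1) u(2) that show ?thesis by blast
qed

lemma partition_set_mem:
  assumes "a \<in> partition_set C p h enum x" "j \<in> {1..omega C p h x}"
  shows "a j \<in> {1..p}"
  using PiE_mem[OF assms(1)[unfolded partition_set_def] assms(2)] by simp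

lemma dom_map_Fin:
  assumes "x \<in> dom_map C p h" "i \<in> {1..p}"
  obtains u where "h i x = Fin u"
proof (cases "h i x")
  case PInf
  have "cless C (h i x) PInf" using assms unfolding dom_map_def by blast
  then show ?thesis using PInf by simp
qed (rule that)

lemma sum_map_FinE:
  assumes "sum_map f g i x = Fin u"
  obtains c where "g i x = Fin c"
  using assms unfolding sum_map_def plus_cext_def by (cases "g i x") auto

text \<open>The minimizer chosen by the method witnesses attainment, so the \<open>LEAST\<close>
  value is the objective at that pair.\<close>

lemma Theta_eq_objective:
  assumes "is_arg_min (objective C p f g l x) (\<lambda>s. s \<in> feasible C p f g enum x) s"
  shows "Theta C p f g enum l x = objective C p f g l x s"
  unfolding Theta_def
proof (rule Least_equality)
  show "objective C p f g l x s \<in> objective C p f g l x ` feasible C p f g enum x"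
    using assms unfolding is_arg_min_def by blast
next
  fix y assume "y \<in> objective C p f g l x ` feasible C p f g enum x"
  then show "objective C p f g l x s \<le> y"
    using assms unfolding is_arg_min_def by (auto simp: not_less)
qed

text \<open>On the domain the subtracted \<open>g (a j) x\<close> is finite, so each model value at
  v = 0 is exactly 0. This provides the competitor showing that \<open>Theta\<close> is
  nonpositive.\<close>

lemma objective_at_zero:
  assumes C: "ordering_cone C" and p: "1 \<le> p"
    and x: "x \<in> dom_map C p (sum_map f g)"
    and a: "a \<in> partition_set C p (sum_map f g) enum x"
  shows "objective C p f g l x (a, 0) = 0"
proof -
  let ?I = "{1..omega C p (sum_map f g) x}"
  have "phi C (model (f (a j)) (g (a j)) x 0) = 0" if j: "j \<in> ?I" for j
  proof -
    obtain u where "sum_map f g (a j) x = Fin u"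
      using dom_map_Fin[OF x partition_set_mem[OF a j]] .
    then obtain c where "g (a j) x = Fin c" by (rule sum_map_FinE)
    then have "model (f (a j)) (g (a j)) x 0 = Fin 0"
      unfolding model_def by (simp add: cext_Fin_simps)
    then show ?thesis using phi_Fin_0[OF C] by simp
  qed
  then have "(\<lambda>j. phi C (model (f (a j)) (g (a j)) x 0)) ` ?I = (\<lambda>j. 0) ` ?I"
    by (intro image_cong) auto
  also have "\<dots> = {0}"
    using omega_pos[OF C p, of "sum_map f g" x] by auto
  finally show ?thesis unfolding objective_def by simp
qed

text \<open>Every power of \<mu> up to the threshold \<tau> passes the line search, so backtracking
  stops no lower than \<mu> \<tau>. The accepted inequality then gives a decrease proportional to
  \<theta> = -\<open>Theta\<close>. The index may change from \<open>i\<close> to \<open>i'\<close>,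
  since only the selected components are tested.\<close>

lemma prox_grad_step_decrease:
  fixes f :: "nat \<Rightarrow> real ^ 'n \<Rightarrow> real ^ 'm"
  assumes C: "ordering_cone C" and p: "1 \<le> p" and h: "h = sum_map f g"
    and f: "\<And>j. j \<in> {1..p} \<Longrightarrow> cont_diff (f j)"
    and lip: "\<And>j. j \<in> {1..p} \<Longrightarrow> grad_lipschitz L (f j)" and L: "0 \<le> L"
    and g: "\<And>j. j \<in> {1..p} \<Longrightarrow> cconvex C (g j)"
    and enum: "minimal_enum C p h enum"
    and \<rho>: "0 < \<rho>" "\<rho> < 1" and \<mu>: "0 < \<mu>" "\<mu> < 1"
    and \<tau>: "0 < \<tau>" "\<tau> \<le> 1" "L * \<tau> \<le> (1 - \<rho>) * l / 2" and l: "0 < l"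
    and step: "prox_grad_step C p f g enum \<rho> \<mu> l x x'"
    and x: "x \<in> dom_map C p h" and x': "x' \<in> dom_map C p h"
  obtains \<theta> where "0 \<le> \<theta>" "Theta C p f g enum l x = ereal (- \<theta>)"
    "\<And>i u. i \<in> {1..p} \<Longrightarrow> h i x = Fin u \<Longrightarrow>
      \<exists>i'\<in>{1..p}. \<exists>u'. h i' x' = Fin u' \<and>
        (\<forall>z\<in>dual_cone C. norm z = 1 \<longrightarrow> z \<bullet> u' \<le> z \<bullet> u - \<rho> * (\<mu> * \<tau>) * \<theta>)"
proof -
  obtain a v i where
    am: "is_arg_min (objective C p f g l x) (\<lambda>s. s \<in> feasible C p f g enum x) (a, v)" and
    ls: "line_search_cond C p f g \<rho> \<mu> x a v i" and
    fails: "\<And>i'. i' < i \<Longrightarrow> \<not> line_search_cond C p f g \<rho> \<mu> x a v i'" and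
    x'_eq: "x' = x + \<mu> ^ i *\<^sub>R v"
    using step unfolding prox_grad_step_def by metis
  let ?I = "{1..omega C p h x}"
  let ?m = "\<lambda>j. model (f (a j)) (g (a j)) x v"
  let ?\<Theta> = "Theta C p f g enum l x"
  let ?Q = "ereal (l / 2 * (norm v)\<^sup>2)"
  have \<Theta>: "?\<Theta> = Max ((\<lambda>j. phi C (?m j)) ` ?I) + ?Q"
    unfolding Theta_eq_objective[OF am] by (simp add: objective_def h)
  have a: "a \<in> partition_set C p h enum x"
    using am unfolding is_arg_min_def feasible_def h by auto
  have "(a, 0) \<in> feasible C p f g enum x"
    using a unfolding feasible_def h by simp
  then have "?\<Theta> \<le> objective C p f g l x (a, 0)"
    unfolding Theta_eq_objective[OF am] using am unfolding is_arg_min_def by (meson not_less)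
  then have \<Theta>_le: "?\<Theta> \<le> 0"
    using objective_at_zero[OF C p] x a unfolding h by metis
  have I: "finite ?I" "?I \<noteq> {}"
    using omega_pos[OF C p] by auto
  have "Max ((\<lambda>j. phi C (?m j)) ` ?I) \<in> (\<lambda>j. phi C (?m j)) ` ?I"
    using I by (intro Max_in) auto
  then obtain j where "Max ((\<lambda>j. phi C (?m j)) ` ?I) = phi C (?m j)" by blast
  \<comment> \<open>The maximum over the nonempty index set is one of the \<open>phi\<close> values,
    none of which is \<open>- \<infinity>\<close>; together with \<open>?\<Theta> \<le> 0\<close>
    this makes \<open>Theta\<close> real.\<close>
  then have "?\<Theta> \<noteq> - \<infinity>"
    unfolding \<Theta> using phi_not_MInf[OF C, of "?m j"] by simp
  then obtain \<theta> where \<theta>: "?\<Theta> = ereal (- \<theta>)" "0 \<le> \<theta>"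
    using \<Theta>_le by (cases ?\<Theta>) (auto, metis add.inverse_inverse neg_0_le_iff_le)
  have phi_le: "phi C (?m j) \<le> ereal (- \<theta> - l / 2 * (norm v)\<^sup>2)" if "j \<in> ?I" for j
  proof -
    have "phi C (?m j) \<le> Max ((\<lambda>j. phi C (?m j)) ` ?I)"
      using that by (intro Max_ge) auto
    then have "phi C (?m j) + ?Q \<le> ereal (- \<theta>)"
      unfolding \<theta>(1)[symmetric] \<Theta> by (rule add_right_mono)
    then show ?thesis by (cases "phi C (?m j)") auto
  qed
  have g_x: "\<exists>c. g (a j) x = Fin c" if "j \<in> ?I" for j
    using dom_map_Fin[OF x partition_set_mem[OF a that]] sum_map_FinE unfolding h by metis
  \<comment> \<open>An infinite \<open>g (a j) (x + v)\<close> would make the model value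
    \<open>PInf\<close> and its \<open>phi\<close> infinite, against the real bound
    \<open>phi_le\<close>.\<close>
  have g_xv: "\<exists>d. g (a j) (x + v) = Fin d" if "j \<in> ?I" for j
  proof (cases "g (a j) (x + v)")
    case PInf
    then have "?m j = PInf" by (simp add: model_def plus_cext_def minus_cext_def)
    then show ?thesis using phi_le[OF that] by simp
  qed simp
  have accept: "line_search_cond C p f g \<rho> \<mu> x a v i'" if "\<mu> ^ i' \<le> \<tau>" for i'
    unfolding line_search_cond_def
  proof
    fix j assume "j \<in> {1..omega C p (sum_map f g) x}"
    then have j: "j \<in> ?I" unfolding h .
    obtain c d where cd: "g (a j) x = Fin c" "g (a j) (x + v) = Fin d"
      using g_x g_xv j by blast
    have aj: "a j \<in> {1..p}" by (rule partition_set_mem[OF a j])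
    have "phi C (?m j) \<le> ereal (- (l / 2 * (norm v)\<^sup>2))"
      by (rule order_trans[OF phi_le[OF j]]) (simp add: \<theta>)
    moreover have "L * \<mu> ^ i' \<le> (1 - \<rho>) * l / 2"
      using mult_left_mono[OF that L] \<tau> by linarith
    ultimately show "cle C (sum_map f g (a j) (x + \<mu> ^ i' *\<^sub>R v))
        (sum_map f g (a j) x + (\<rho> * \<mu> ^ i') *\<^sub>R ?m j)"
      unfolding sum_map_def using that \<tau> \<mu> \<rho>
      by (intro line_search_accepts[OF C f[OF aj] lip[OF aj] L g[OF aj] cd]) auto
  qed
  \<comment> \<open>Either the full step 1 is accepted, or the previous power was rejected and hence
    exceeds \<tau>; one more factor \<mu> gives the bound.\<close>
  have step_size: "\<mu> * \<tau> \<le> \<mu> ^ i"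
  proof (cases i)
    case 0
    then show ?thesis using \<mu> \<tau> by (simp add: mult_le_one)
  next
    case (Suc i')
    then have "\<not> \<mu> ^ i' \<le> \<tau>" using accept fails by blast
    then show ?thesis using Suc \<mu> by simp
  qed
  have "\<exists>i'\<in>{1..p}. \<exists>u'. h i' x' = Fin u' \<and>
      (\<forall>z\<in>dual_cone C. norm z = 1 \<longrightarrow> z \<bullet> u' \<le> z \<bullet> u - \<rho> * (\<mu> * \<tau>) * \<theta>)"
    if k: "k \<in> {1..p}" and u: "h k x = Fin u" for k u
  proof -
    obtain j where j: "j \<in> ?I" "cle C (h (a j) x) (h k x)"
      using partition_set_below[OF C enum a k] .
    have aj: "a j \<in> {1..p}" by (rule partition_set_mem[OF a j(1)])
    obtain s where s: "h (a j) x = Fin s" using dom_map_Fin[OF x aj] .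
    obtain u' where u': "h (a j) x' = Fin u'" using dom_map_Fin[OF x' aj] .
    obtain c d where "g (a j) x = Fin c" "g (a j) (x + v) = Fin d"
      using g_x g_xv j by blast
    then obtain w where w: "?m j = Fin w"
      unfolding model_def by (simp add: cext_Fin_simps)
    have "cle C (h (a j) x') (h (a j) x + (\<rho> * \<mu> ^ i) *\<^sub>R ?m j)"
      using ls j(1) unfolding line_search_cond_def h x'_eq by blast
    then have ls_C: "s + (\<rho> * \<mu> ^ i) *\<^sub>R w - u' \<in> C"
      unfolding u' s w by (simp add: cext_Fin_simps)
    have us: "u - s \<in> C" using j(2) unfolding u s by simp
    have "z \<bullet> u' \<le> z \<bullet> u - \<rho> * (\<mu> * \<tau>) * \<theta>" if z: "z \<in> dual_cone C" "norm z = 1" for z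
    proof -
      have "z \<bullet> w \<le> - \<theta> - l / 2 * (norm v)\<^sup>2"
        using phi_le[OF j(1)] z unfolding w phi_Fin_le_iff by blast
      \<comment> \<open>The quadratic term has already served to accept the step; here only the
        bound by -\<theta> is kept.\<close>
      also have "\<dots> \<le> - \<theta>" using l by simp
      finally have "(\<rho> * \<mu> ^ i) * (z \<bullet> w) \<le> (\<rho> * \<mu> ^ i) * (- \<theta>)"
        using \<rho> \<mu> by (intro mult_left_mono) auto
      moreover have "\<rho> * (\<mu> * \<tau>) * \<theta> \<le> \<rho> * \<mu> ^ i * \<theta>"
        using step_size \<rho> \<theta>(2) by (intro mult_right_mono mult_left_mono) auto
      moreover have "0 \<le> z \<bullet> (s + (\<rho> * \<mu> ^ i) *\<^sub>R w - u')" "0 \<le> z \<bullet> (u - s)"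
        using ls_C us z(1) unfolding dual_cone_def by (auto simp: inner_commute)
      ultimately show ?thesis by (simp add: inner_diff_right inner_add_right)
    qed
    with aj u' show ?thesis by blast
  qed
  with \<theta> that show ?thesis by blast
qed

section \<open>The convergence rate\<close>

theorem theorem5p3:
  fixes C :: "(real ^ 'm) set"
    and p :: nat
    and f :: "nat \<Rightarrow> real ^ 'n \<Rightarrow> real ^ 'm"
    and g h :: "nat \<Rightarrow> real ^ 'n \<Rightarrow> (real ^ 'm) cext"
    and H :: "real ^ 'n \<Rightarrow> (real ^ 'm) cext set"
    and enum :: "real ^ 'n \<Rightarrow> nat \<Rightarrow> (real ^ 'm) cext"
    and Lc :: "nat \<Rightarrow> real" and L \<rho> \<mu> l :: real
    and \<L> :: "(real ^ 'n) set"
    and x0 :: "real ^ 'n"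
    and X :: "nat \<Rightarrow> real ^ 'n"
  assumes C: "ordering_cone C"
    and p: "1 \<le> p"
    and h: "h = sum_map f g"
    and H: "H = set_map p h"
    and f: "\<And>j. j \<in> {1..p} \<Longrightarrow> cont_diff (f j)"
    and g: "\<And>j. j \<in> {1..p} \<Longrightarrow> cproper (g j) \<and> cclosed C (g j) \<and> cconvex C (g j)"
    and enum: "minimal_enum C p h enum"
    and x0: "x0 \<in> dom_map C p h"
    and level: "\<L> = {x. set_le C (H x) (H x0)}"
    and bounded_below:
      "\<And>S :: nat \<Rightarrow> (real ^ 'm) cext set.
         (\<forall>k. S k \<in> {H x |x. x \<in> \<L>}) \<Longrightarrow> (\<forall>k. set_le C (S (Suc k)) (S k)) \<Longrightarrow>
         (\<exists>B :: (real ^ 'm) set. bounded B \<and> (\<forall>k. set_le C (Fin ` B) (S k)))"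
    and lipschitz: "\<And>j. j \<in> {1..p} \<Longrightarrow> grad_lipschitz (Lc j) (f j)"
    and L: "L = Max (Lc ` {1..p})"
    and \<rho>: "0 < \<rho>" "\<rho> < 1"
    and \<mu>: "0 < \<mu>" "\<mu> < 1"
    and l: "0 < l"
    and X_init: "X 0 = x0"
    and X_step: "\<And>k. prox_grad_step C p f g enum \<rho> \<mu> l (X k) (X (Suc k))"
    and X_dom: "\<And>k. X k \<in> dom_map C p h"
    and X_nonstationary: "\<And>k. \<not> stationary C p h enum (X k)"
  shows "\<exists>C1 :: real. C1 > 0 \<and>
    (\<forall>K::nat. K \<ge> 1 \<longrightarrow> (\<exists>k\<in>{0..K}. \<bar>Theta C p f g enum l (X k)\<bar> < ereal (C1 / real K)))"
proof -
  \<comment> \<open>A strictly positive common Lipschitz constant, so that \<tau> may divide by it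
    even when L = 0.\<close>
  define L' where "L' = \<bar>L\<bar> + 1"
  \<comment> \<open>The largest step size up to 1 with L' \<tau> \<le> (1 - \<rho>) l / 2.\<close>
  define \<tau> where "\<tau> = min 1 ((1 - \<rho>) * l / (2 * L'))"
  define \<delta> where "\<delta> = \<rho> * (\<mu> * \<tau>)"
  have L': "0 < L'" unfolding L'_def by simp
  have "Lc j \<le> L'" if "j \<in> {1..p}" for j
  proof -
    have "Lc j \<le> L" unfolding L using that by (intro Max_ge) auto
    then show ?thesis unfolding L'_def by linarith
  qed
  then have lip': "\<And>j. j \<in> {1..p} \<Longrightarrow> grad_lipschitz L' (f j)"
    using lipschitz grad_lipschitz_mono by blast
  have "L' * \<tau> \<le> L' * ((1 - \<rho>) * l / (2 * L'))"
    unfolding \<tau>_def using L' by (intro mult_left_mono) auto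
  then have \<tau>: "0 < \<tau>" "\<tau> \<le> 1" "L' * \<tau> \<le> (1 - \<rho>) * l / 2"
    using L' \<rho> l by (auto simp: \<tau>_def)
  have \<delta>: "0 < \<delta>" unfolding \<delta>_def using \<rho> \<mu> \<tau> by simp
  \<comment> \<open>Bundles the value \<theta> with its descent property, so that one choice over
    all \<open>k\<close> yields the sequence \<theta>.\<close>
  define P where "P k t \<longleftrightarrow> 0 \<le> t \<and> Theta C p f g enum l (X k) = ereal (- t) \<and>
      (\<forall>i\<in>{1..p}. \<forall>u. h i (X k) = Fin u \<longrightarrow> (\<exists>i'\<in>{1..p}. \<exists>u'. h i' (X (Suc k)) = Fin u' \<and>
        (\<forall>z\<in>dual_cone C. norm z = 1 \<longrightarrow> z \<bullet> u' \<le> z \<bullet> u - \<delta> * t)))" for k t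
  have g': "\<And>j. j \<in> {1..p} \<Longrightarrow> cconvex C (g j)" using g by blast
  have "\<exists>t. P k t" for k
  proof -
    obtain t where "0 \<le> t" "Theta C p f g enum l (X k) = ereal (- t)"
      "\<And>i u. i \<in> {1..p} \<Longrightarrow> h i (X k) = Fin u \<Longrightarrow>
        \<exists>i'\<in>{1..p}. \<exists>u'. h i' (X (Suc k)) = Fin u' \<and>
          (\<forall>z\<in>dual_cone C. norm z = 1 \<longrightarrow> z \<bullet> u' \<le> z \<bullet> u - \<rho> * (\<mu> * \<tau>) * t)"
      using prox_grad_step_decrease[OF C p h f lip' less_imp_le[OF L'] g' enum \<rho> \<mu> \<tau> l
          X_step[of k] X_dom X_dom] by metis
    then have "P k t" unfolding P_def \<delta>_def by blast
    then show ?thesis ..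
  qed
  then obtain \<theta> where P: "\<And>k. P k (\<theta> k)" by metis
  have \<theta>: "0 \<le> \<theta> k" "Theta C p f g enum l (X k) = ereal (- \<theta> k)" for k
    using P[of k] unfolding P_def by blast+
  have decrease: "\<exists>i'\<in>{1..p}. \<exists>u'. h i' (X (Suc k)) = Fin u' \<and>
        (\<forall>z\<in>dual_cone C. norm z = 1 \<longrightarrow> z \<bullet> u' \<le> z \<bullet> u - \<delta> * \<theta> k)"
    if "i \<in> {1..p}" "h i (X k) = Fin u" for k i u
    using P[of k] that unfolding P_def by blast

  \<comment> \<open>Descent of the sets H(x^k) and the common lower bound\<close>
  have H_Suc: "set_le C (H (X (Suc k))) (H (X k))" for k
    unfolding set_le_def
  proof
    fix v assume "v \<in> H (X k)"
    then obtain i where i: "i \<in> {1..p}" "v = h i (X k)"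
      unfolding H set_map_def by blast
    obtain u where u: "h i (X k) = Fin u" using dom_map_Fin[OF X_dom i(1)] .
    obtain i' u' where i': "i' \<in> {1..p}" "h i' (X (Suc k)) = Fin u'"
      and dec: "\<And>z. z \<in> dual_cone C \<Longrightarrow> norm z = 1 \<Longrightarrow> z \<bullet> u' \<le> z \<bullet> u - \<delta> * \<theta> k"
      using decrease[OF i(1) u] by blast
    have "u - u' \<in> C"
    proof (rule mem_ordering_coneI[OF C])
      fix z assume "z \<in> dual_cone C" "norm z = 1"
      then have "z \<bullet> u' \<le> z \<bullet> u - \<delta> * \<theta> k" by (rule dec)
      moreover have "0 \<le> \<delta> * \<theta> k" using \<delta> \<theta>(1) by simp
      ultimately show "0 \<le> z \<bullet> (u - u')" by (simp add: inner_diff_right)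
    qed
    then have "cle C (h i' (X (Suc k))) v" using i i' u by simp
    then show "\<exists>u\<in>H (X (Suc k)). cle C u v"
      using i' unfolding H set_map_def by blast
  qed
  \<comment> \<open>The lower bound is assumed only for descending sequences of values of H on the
    level set.\<close>
  have X_level: "X k \<in> \<L>" for k
  proof (induction k)
    case 0
    show ?case unfolding level using cle_refl[OF C] by (auto simp: set_le_def X_init)
  next
    case (Suc k)
    then show ?case using set_le_trans[OF C H_Suc] unfolding level by blast
  qed
  obtain B :: "(real ^ 'm) set" where B: "bounded B" "\<And>k. set_le C (Fin ` B) (H (X k))"
    using bounded_below[of "\<lambda>k. H (X k)"] X_level H_Suc by blast

  \<comment> \<open>Telescoping along one dual direction\<close>
  obtain M where M: "\<And>b. b \<in> B \<Longrightarrow> norm b \<le> M" using B(1) bounded_iff by metis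
  obtain z where z: "z \<in> dual_cone C" "norm z = 1" using dual_cone_unit_exists[OF C] .
  have one: "1 \<in> {1..p}" using p by simp
  obtain u0 where u0: "h 1 (X 0) = Fin u0" using dom_map_Fin[OF X_dom one] .
  \<comment> \<open>The dual vector \<open>z\<close> stays fixed while the index may change at each
    step, so the index is existentially quantified inside the induction.\<close>
  have chain: "\<exists>i\<in>{1..p}. \<exists>u. h i (X k) = Fin u \<and> z \<bullet> u \<le> z \<bullet> u0 - \<delta> * (\<Sum>j<k. \<theta> j)" for k
  proof (induction k)
    case 0
    show ?case using one u0 by auto
  next
    case (Suc k)
    then obtain i u where i: "i \<in> {1..p}" "h i (X k) = Fin u"
      and u: "z \<bullet> u \<le> z \<bullet> u0 - \<delta> * (\<Sum>j<k. \<theta> j)" by blast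
    obtain i' u' where i': "i' \<in> {1..p}" "h i' (X (Suc k)) = Fin u'"
      and "z \<bullet> u' \<le> z \<bullet> u - \<delta> * \<theta> k"
      using decrease[OF i] z by blast
    with u have "z \<bullet> u' \<le> z \<bullet> u0 - \<delta> * (\<Sum>j<Suc k. \<theta> j)"
      by (simp add: algebra_simps)
    with i' show ?case by blast
  qed
  define D where "D = z \<bullet> u0 + M"
  have sum_le: "\<delta> * (\<Sum>j<k. \<theta> j) \<le> D" for k
  proof -
    obtain i u where i: "i \<in> {1..p}" "h i (X k) = Fin u"
      and u: "z \<bullet> u \<le> z \<bullet> u0 - \<delta> * (\<Sum>j<k. \<theta> j)" using chain by blast
    have "Fin u \<in> H (X k)" using i unfolding H set_map_def by (metis imageI)
    \<comment> \<open>Some \<open>b\<close> in the bounded set lies below \<open>u\<close>, so z . u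
      \<ge> z . b \<ge> -M; this caps the accumulated decrease.\<close>
    then obtain b where b: "b \<in> B" "u - b \<in> C"
      using B(2)[of k] unfolding set_le_def by fastforce
    have "0 \<le> z \<bullet> (u - b)" using b(2) z(1) unfolding dual_cone_def by (auto simp: inner_commute)
    moreover have "- M \<le> z \<bullet> b"
      using Cauchy_Schwarz_ineq2[of z b] z(2) M[OF b(1)] by simp
    ultimately show ?thesis using u unfolding D_def by (simp add: inner_diff_right)
  qed
  have "0 \<le> D" using sum_le[of 0] by simp
  \<comment> \<open>The extra 1 gives \<delta> C1 = D + 1 > D, which yields the strict inequality.
    The constant is fixed before \<open>K\<close>.\<close>
  define C1 where "C1 = (D + 1) / \<delta>"
  have "0 < C1" unfolding C1_def using \<open>0 \<le> D\<close> \<delta> by simp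
  moreover have "\<exists>k\<in>{0..K}. \<bar>Theta C p f g enum l (X k)\<bar> < ereal (C1 / real K)"
    if K: "1 \<le> K" for K :: nat
  proof (rule ccontr)
    assume neg: "\<not> (\<exists>k\<in>{0..K}. \<bar>Theta C p f g enum l (X k)\<bar> < ereal (C1 / real K))"
    \<comment> \<open>The indices below \<open>K\<close> give exactly \<open>K\<close> terms, so
      their lower bounds add up to \<open>C1\<close>.\<close>
    have "C1 / real K \<le> \<theta> k" if "k < K" for k
      using neg that \<theta>(1)[of k] by (auto simp: \<theta>(2) not_less dest: bspec[where x = k])
    then have "(\<Sum>j<K. C1 / real K) \<le> (\<Sum>j<K. \<theta> j)"
      by (intro sum_mono) simp
    then have "C1 \<le> (\<Sum>j<K. \<theta> j)" using K by simp
    then have "\<delta> * C1 \<le> D"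
      using sum_le[of K] \<delta> by (meson less_imp_le mult_left_mono order_trans)
    then show False unfolding C1_def using \<delta> by simp
  qed
  ultimately show ?thesis by blast
qed

end
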